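(* Let $n\ge2$ and $X=\mathrm{Sp}_{2n}(2)$. Let $\Gamma$ be an $X$-strongly incidence-transitive code in $J(\mathcal{Q}^\epsilon,k)$ for some $k$ with $2\le k\le|\mathcal{Q}^\epsilon|-2$, and let $\Delta\in\Gamma$. Suppose $X_\Delta\le X_U$ for some totally isotropic $d$-dimensional subspace $U$ of $V$, where $(d,\epsilon)\ne(n,-)$. Then $\Gamma=\Gamma(n,d,\epsilon,\delta)$ for some $\delta\in\{0,1\}$, and $k=2^{n-1}(2^{n-d}+\epsilon)$ if $\delta=0$, $k=2^{2n-d-1}(2^d-1)$ if $\delta=1$.
   Context: Let $V=\mathbb{F}_2^{2n}$ with a symplectic form $B$, and $X=\mathrm{Sp}_{2n}(2)$ its isometry group (acting on the right). $\mathcal{Q}^\epsilon$ ($\epsilon\in\{+,-\}$) is the set of quadratic forms $\phi:V\to\mathbb{F}_2$ of type $\epsilon$ with $\phi(x+y)+\phi(x)+\phi(y)=B(x,y)$; signs are $\pm1$ in arithmetic, $|\mathcal{Q}^\epsilon|=2^{n-1}(2^n+\epsilon)$. $X$ acts on $\mathcal{Q}^\epsilon$ by $\phi^g(x)=\phi(xg^{-1})$. A subspace $U$ is totally isotropic if $B(u,u')=0$ for all $u,u'\in U$; $X_U$ is its setwise stabiliser; $\mathrm{Sing}(\phi)=\{x:\phi(x)=0\}$. $J(\mathcal V,k)$: vertices the $k$-subsets of $\mathcal V$, adjacent iff they meet in $k-1$ points; a code is a nonempty vertex set; $\Gamma$ is $G$-strongly incidence-transitive if $G$ (permuting $\mathcal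 V$, preserving $\Gamma$) is transitive on $\Gamma$ and each $G_\Delta$ is transitive on $\Delta\times(\mathcal V\setminus\Delta)$. For $1\le d\le n$, $(d,\epsilon)\ne(n,-)$, $\delta\in\{0,1\}$, $\Gamma(n,d,\epsilon,\delta)$ is the code in $J(\mathcal{Q}^\epsilon,k)$ (with $k$ as in the claim) consisting of $\Delta^\delta(U)=\{\phi\in\mathcal{Q}^\epsilon:\dim(\mathrm{Sing}(\phi)\cap U)=d-\delta\}$ for all totally isotropic $d$-dimensional $U$. *)

theory Defs
  imports "HOL-Analysis.Analysis" "HOL-Library.Z2"
begin

definition johnson_verts :: "'a set \<Rightarrow> nat \<Rightarrow> 'a set set" where
  "johnson_verts P k = {D. D \<subseteq> P \<and> finite D \<and> card D = k}"

definition johnson_graph :: "'a set \<Rightarrow> nat \<Rightarrow> 'a set set \<times> ('a set \<times> 'a set) set" where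
  "johnson_graph P k =
     (johnson_verts P k,
      {(D, E). D \<in> johnson_verts P k \<and> E \<in> johnson_verts P k \<and> card (D \<inter> E) + 1 = k})"

definition is_code :: "'v set \<times> ('v \<times> 'v) set \<Rightarrow> 'v set \<Rightarrow> bool" where
  "is_code J C \<longleftrightarrow> C \<subseteq> fst J \<and> C \<noteq> {}"

definition setwise_stabiliser :: "'g set \<Rightarrow> ('g \<Rightarrow> 'a \<Rightarrow> 'a) \<Rightarrow> 'a set \<Rightarrow> 'g set" where
  "setwise_stabiliser G act D = {g \<in> G. act g ` D = D}"

definition strongly_incidence_transitive ::
    "'g set \<Rightarrow> ('g \<Rightarrow> 'a \<Rightarrow> 'a) \<Rightarrow> 'a set \<Rightarrow> 'a set set \<Rightarrow> bool" where
  "strongly_incidence_transitive G act P C \<longleftrightarrow>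
     (\<forall>g\<in>G. bij_betw (act g) P P) \<and>
     (\<forall>g\<in>G. \<forall>D\<in>C. act g ` D \<in> C) \<and>
     (\<forall>D\<in>C. \<forall>E\<in>C. \<exists>g\<in>G. act g ` D = E) \<and>
     (\<forall>D\<in>C. \<forall>(x, y) \<in> D \<times> (P - D). \<forall>(x', y') \<in> D \<times> (P - D).
        \<exists>g \<in> setwise_stabiliser G act D. act g x = x' \<and> act g y = y')"

definition symplectic_form :: "(bit^'m \<Rightarrow> bit^'m \<Rightarrow> bit) \<Rightarrow> bool" where
  "symplectic_form B \<longleftrightarrow>
     (\<forall>x. Vector_Spaces.linear (*s) (*) (\<lambda>y. B x y)) \<and>
     (\<forall>y. Vector_Spaces.linear (*s) (*) (\<lambda>x. B x y)) \<and>
     (\<forall>x. B x x = 0) \<and>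
     (\<forall>x. (\<forall>y. B x y = 0) \<longrightarrow> x = 0)"

text \<open>Group elements are functions, so the image of a vector \<open>x\<close> under \<open>g\<close>, in
  right-action notation \<open>xg\<close>, is written \<open>g x\<close>.\<close>

definition Sp :: "(bit^'m \<Rightarrow> bit^'m \<Rightarrow> bit) \<Rightarrow> (bit^'m \<Rightarrow> bit^'m) set" where
  "Sp B = {g. Vector_Spaces.linear (*s) (*s) g \<and> bij g \<and> (\<forall>x y. B (g x) (g y) = B x y)}"

definition totally_isotropic :: "(bit^'m \<Rightarrow> bit^'m \<Rightarrow> bit) \<Rightarrow> (bit^'m) set \<Rightarrow> bool" where
  "totally_isotropic B U \<longleftrightarrow> vec.subspace U \<and> (\<forall>u\<in>U. \<forall>v\<in>U. B u v = 0)"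

definition quadratic_form_polarising_to ::
    "(bit^'m \<Rightarrow> bit^'m \<Rightarrow> bit) \<Rightarrow> (bit^'m \<Rightarrow> bit) \<Rightarrow> bool" where
  "quadratic_form_polarising_to B \<phi> \<longleftrightarrow>
     (\<forall>c x. \<phi> (c *s x) = c^2 * \<phi> x) \<and> (\<forall>x y. \<phi> (x + y) + \<phi> x + \<phi> y = B x y)"

definition Sing :: "(bit^'m \<Rightarrow> bit) \<Rightarrow> (bit^'m) set" where
  "Sing \<phi> = {x. \<phi> x = 0}"

definition witt_index :: "(bit^'m \<Rightarrow> bit) \<Rightarrow> nat" where
  "witt_index \<phi> = Max {vec.dim W | W. vec.subspace W \<and> W \<subseteq> Sing \<phi>}"

text \<open>A nondegenerate quadratic form in dimension \<open>2n\<close> has type \<open>+\<close> if its Witt index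
  is \<open>n\<close> and type \<open>-\<close> if its Witt index is \<open>n - 1\<close>; the types are encoded as the
  integers \<open>1\<close> and \<open>-1\<close>.\<close>

definition has_type :: "(bit^'m \<Rightarrow> bit) \<Rightarrow> int \<Rightarrow> bool" where
  "has_type \<phi> \<epsilon> \<longleftrightarrow>
     \<epsilon> = 1 \<and> 2 * witt_index \<phi> = CARD('m) \<or>
     \<epsilon> = -1 \<and> 2 * (witt_index \<phi> + 1) = CARD('m)"

definition quad_forms :: "(bit^'m \<Rightarrow> bit^'m \<Rightarrow> bit) \<Rightarrow> int \<Rightarrow> (bit^'m \<Rightarrow> bit) set" where
  "quad_forms B \<epsilon> = {\<phi>. quadratic_form_polarising_to B \<phi> \<and> has_type \<phi> \<epsilon>}"

definition form_act :: "(bit^'m \<Rightarrow> bit^'m) \<Rightarrow> (bit^'m \<Rightarrow> bit) \<Rightarrow> (bit^'m \<Rightarrow> bit)" where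
  "form_act g \<phi> = (\<lambda>x. \<phi> (inv g x))"

text \<open>The parameter \<open>n\<close> is carried by the index type, \<open>CARD('m) = 2n\<close>.\<close>

definition Delta_set ::
    "(bit^'m \<Rightarrow> bit^'m \<Rightarrow> bit) \<Rightarrow> nat \<Rightarrow> int \<Rightarrow> nat \<Rightarrow> (bit^'m) set \<Rightarrow> (bit^'m \<Rightarrow> bit) set" where
  "Delta_set B d \<epsilon> \<delta> U = {\<phi> \<in> quad_forms B \<epsilon>. vec.dim (Sing \<phi> \<inter> U) = d - \<delta>}"

definition Gamma_code ::
    "(bit^'m \<Rightarrow> bit^'m \<Rightarrow> bit) \<Rightarrow> nat \<Rightarrow> int \<Rightarrow> nat \<Rightarrow> (bit^'m \<Rightarrow> bit) set set" where
  "Gamma_code B d \<epsilon> \<delta> =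
     {Delta_set B d \<epsilon> \<delta> U | U. totally_isotropic B U \<and> vec.dim U = d}"

end

theory Submission
  imports Defs
begin

text \<open>
  A form restricted to a totally isotropic \<open>U\<close> is additive, so it vanishes on \<open>U\<close> or on a
  hyperplane of \<open>U\<close>: the two sets \<open>Delta_set\<close> with \<open>\<delta> = 0\<close> and \<open>\<delta> = 1\<close> partition the forms of
  type \<open>\<epsilon>\<close>, and the stabiliser of \<open>U\<close> preserves both. As the stabiliser of \<open>\<Delta>\<close> fixes \<open>U\<close> and has
  only the orbits \<open>\<Delta>\<close> and its complement, \<open>\<Delta>\<close> is one of the two sets once both are nonempty.
  The rest is Witt's theorem for totally isotropic subspaces, proved with transvections, and the
  count, which uses that a form \<open>\<phi>\<close> has type \<open>\<epsilon>\<close> exactly if its Gauss sum, the sum of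
  \<open>(-1)^\<phi>(x)\<close> over all \<open>x\<close>, is \<open>\<epsilon> * 2^n\<close>.
\<close>

section \<open>Sign sums over binary spaces\<close>

instance bit :: finite
proof
  have "(UNIV :: bit set) = {0, 1}"
    by (auto intro: bit.exhaust)
  then show "finite (UNIV :: bit set)"
    by (metis finite.emptyI finite.insertI)
qed

lemma CARD_bit [simp]: "CARD(bit) = 2"
proof -
  have "(UNIV :: bit set) = {0, 1}"
    by (auto intro: bit.exhaust)
  then show ?thesis by (metis card_2_iff zero_neq_one)
qed

text \<open>These library rules rewrite sums and products of bits into bitwise operations, where the
  ring lemmas no longer apply.\<close>

declare add_bit_eq_xor [simp del] mult_bit_eq_and [simp del]

lemma bit_add_self [simp]: "a + a = (0 :: bit)"
  by (cases a) simp_all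

lemma bit_add_eq_0_iff [simp]: "a + b = 0 \<longleftrightarrow> a = (b :: bit)"
  by (cases a; cases b) simp_all

text \<open>The nontrivial character of the additive group of the field, with integer values so that
  its sums count.\<close>

definition chi :: "bit \<Rightarrow> int" where
  "chi b = (if b = 0 then 1 else -1)"

lemma chi_0 [simp]: "chi 0 = 1"
  and chi_1 [simp]: "chi 1 = -1"
  by (simp_all add: chi_def)

lemma chi_add: "chi (a + b) = chi a * chi b"
  by (cases a; cases b) simp_all

lemma vec_bit_add_self [simp]: "x + x = (0 :: bit^'m)"
  by (simp add: vec_eq_iff)

lemma vec_bit_add_self_left [simp]: "x + (x + y) = (y :: bit^'m)"
  by (simp add: add.assoc[symmetric])

lemma subspace_bit_iff:
  "vec.subspace (W :: (bit^'m) set) \<longleftrightarrow> 0 \<in> W \<and> (\<forall>x\<in>W. \<forall>y\<in>W. x + y \<in> W)"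
proof -
  have "c *s x \<in> W" if "0 \<in> W" "x \<in> W" for c :: bit and x
    using that by (cases c) auto
  then show ?thesis
    unfolding vec.subspace_def by blast
qed

text \<open>Orthogonality of characters: if \<open>f a = 1\<close>, translation by \<open>a\<close>
  permutes \<open>W\<close> and flips every sign, so the sum equals its own negative.\<close>

lemma sum_chi_subspace:
  fixes f :: "bit^'m \<Rightarrow> bit"
  assumes W: "vec.subspace W" and add: "\<And>x y. x \<in> W \<Longrightarrow> y \<in> W \<Longrightarrow> f (x + y) = f x + f y"
  shows "(\<Sum>x\<in>W. chi (f x)) = (if \<forall>x\<in>W. f x = 0 then int (card W) else 0)"
proof (cases "\<forall>x\<in>W. f x = 0")
  case True
  then show ?thesis by simp
next
  case False
  then obtain a where a: "a \<in> W" "f a = 1"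
    by (metis (full_types) bit_not_zero_iff)
  have "bij_betw (\<lambda>x. a + x) W W"
    by (rule bij_betw_byWitness[where f' = "\<lambda>x. a + x"]) (use W a in \<open>auto simp: subspace_bit_iff\<close>)
  then have "(\<Sum>x\<in>W. chi (f x)) = (\<Sum>x\<in>W. chi (f (a + x)))"
    by (rule sum.reindex_bij_betw[symmetric])
  also have "\<dots> = (\<Sum>x\<in>W. - chi (f x))"
    by (rule sum.cong) (use a add in \<open>auto simp: chi_add\<close>)
  finally show ?thesis
    using False by (auto simp: sum_negf)
qed

text \<open>With scalars 0 and 1 only, adjoining \<open>a\<close> adds to the span of
  \<open>S\<close> just its disjoint translate by \<open>a\<close>, so the size doubles.\<close>

lemma card_span_independent:
  fixes S :: "(bit^'m) set"
  assumes "finite S" "vec.independent S"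
  shows "card (vec.span S) = 2 ^ card S"
  using assms
proof (induction S rule: finite_induct)
  case empty
  then show ?case by simp
next
  case (insert a S)
  then have a: "a \<notin> vec.span S" and S: "vec.independent S"
    by (auto simp: vec.independent_insert)
  have "vec.span (insert a S) = vec.span S \<union> (\<lambda>x. a + x) ` vec.span S" (is "_ = ?R")
  proof (intro equalityI subsetI)
    fix x assume "x \<in> vec.span (insert a S)"
    then obtain c where c: "x - c *s a \<in> vec.span S"
      by (auto simp: vec.span_breakdown_eq)
    show "x \<in> ?R"
    proof (cases c)
      case zero
      then show ?thesis using c by simp
    next
      case one
      then have "x = a + (x - c *s a)" by simp
      then show ?thesis using c by blast
    qed
  next
    fix x assume "x \<in> ?R"
    then show "x \<in> vec.span (insert a S)"
      by (auto intro: vec.span_add vec.span_base subsetD[OF vec.span_mono[of S "insert a S"]])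
  qed
  moreover have "vec.span S \<inter> (\<lambda>x. a + x) ` vec.span S = {}"
  proof -
    have "a \<in> vec.span S" if "x \<in> vec.span S" "a + x \<in> vec.span S" for x
      using vec.span_diff[OF that(2,1)] by simp
    then show ?thesis using a by blast
  qed
  moreover have "card ((\<lambda>x. a + x) ` vec.span S) = card (vec.span S)"
    by (rule card_image) (simp add: inj_on_def)
  ultimately show ?case
    using insert S by (simp add: card_Un_disjoint)
qed

lemma card_subspace:
  assumes "vec.subspace (W :: (bit^'m) set)"
  shows "card W = 2 ^ vec.dim W"
proof -
  obtain S where S: "S \<subseteq> W" "vec.independent S" "W \<subseteq> vec.span S" "card S = vec.dim W"
    using vec.basis_exists by blast
  then have "vec.span S = W"
    using assms vec.span_minimal by blast
  then show ?thesis
    using card_span_independent[of S] S by simp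
qed

section \<open>Symplectic spaces\<close>

locale symplectic =
  fixes B :: "bit^'m \<Rightarrow> bit^'m \<Rightarrow> bit"
  assumes symplectic: "symplectic_form B"
begin

lemma add_right: "B x (y + z) = B x y + B x z"
  and add_left: "B (x + y) z = B x z + B y z"
  and self [simp]: "B x x = 0"
  and nondegenerate: "(\<And>y. B x y = 0) \<Longrightarrow> x = 0"
  using symplectic unfolding symplectic_form_def
  by (auto dest: Vector_Spaces.linear.axioms module_hom.add simp: Vector_Spaces.linear_def module_hom_def module_hom_axioms_def)

lemma zero_right [simp]: "B x 0 = 0"
  using add_right[of x 0 0] by simp

lemma zero_left [simp]: "B 0 x = 0"
  using add_left[of 0 0 x] by simp

lemma sym: "B x y = B y x"
proof -
  have "B (x + y) (x + y) = B x y + B y x"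
    unfolding add_left add_right by simp
  then show ?thesis
    by simp
qed

definition perp :: "(bit^'m) set \<Rightarrow> (bit^'m) set" where
  "perp W = {x. \<forall>w\<in>W. B w x = 0}"

lemma subspace_perp: "vec.subspace (perp W)"
  by (auto simp: subspace_bit_iff perp_def add_right)

lemma sum_chi_form:
  assumes "vec.subspace W"
  shows "(\<Sum>w\<in>W. chi (B w x)) = (if x \<in> perp W then int (card W) else 0)"
  using sum_chi_subspace[OF assms, of "\<lambda>w. B w x"] by (simp add: add_left perp_def)

lemma perp_UNIV: "x \<in> perp UNIV \<longleftrightarrow> x = 0"
  using nondegenerate by (auto simp: perp_def sym[of _ x])

text \<open>Double counting of \<open>chi (B w x)\<close>: summing over \<open>W\<close> first
  detects \<open>perp W\<close>, while summing over the whole space first leaves only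
  \<open>w = 0\<close>.\<close>

lemma card_perp:
  assumes W: "vec.subspace W"
  shows "card W * card (perp W) = CARD(bit^'m)"
proof -
  have "int (card W * card (perp W)) = (\<Sum>x\<in>UNIV. if x \<in> perp W then int (card W) else 0)"
    by (simp add: sum.If_cases)
  also have "\<dots> = (\<Sum>x\<in>UNIV. \<Sum>w\<in>W. chi (B w x))"
    by (simp add: sum_chi_form W)
  also have "\<dots> = (\<Sum>w\<in>W. \<Sum>x\<in>UNIV. chi (B x w))"
    by (subst sum.swap) (simp add: sym)
  also have "\<dots> = (\<Sum>w\<in>W. if w = 0 then int CARD(bit^'m) else 0)"
    by (simp add: sum_chi_form perp_UNIV)
  also have "\<dots> = int CARD(bit^'m)"
    using W by (simp add: subspace_bit_iff)
  finally show ?thesis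
    by (simp only: of_nat_eq_iff)
qed

text \<open>One inclusion is immediate, and \<open>card_perp\<close> for \<open>W\<close> and for
  \<open>perp W\<close> gives equal sizes.\<close>

lemma perp_perp:
  assumes W: "vec.subspace W"
  shows "perp (perp W) = W"
proof -
  have "card W * card (perp W) = card (perp (perp W)) * card (perp W)"
    using card_perp[OF W] card_perp[OF subspace_perp, of W] by (simp add: mult.commute)
  moreover have "card (perp W) \<noteq> 0"
    using subspace_perp[of W] by (auto simp: subspace_bit_iff)
  ultimately have "card W = card (perp (perp W))"
    by simp
  moreover have "W \<subseteq> perp (perp W)"
    by (auto simp: perp_def sym)
  ultimately show ?thesis
    by (metis card_subset_eq finite)
qed

text \<open>The signed count of pairs \<open>(a, u)\<close> below is nonzero, while a missing \<open>a\<close> would make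
  every inner sum vanish.\<close>

lemma additive_eq_form:
  assumes W: "vec.subspace W" and add: "\<And>x y. x \<in> W \<Longrightarrow> y \<in> W \<Longrightarrow> f (x + y) = f x + f y"
  shows "\<exists>a. \<forall>x\<in>W. f x = B a x"
proof (rule ccontr)
  assume no: "\<not> ?thesis"
  have "0 \<in> W" using W by (simp add: subspace_bit_iff)
  then have "f 0 = 0" using add[of 0 0] by simp
  have "(\<Sum>u\<in>W. chi (f u + B a u)) = 0" for a
  proof -
    have "\<exists>x\<in>W. f x + B a x \<noteq> 0"
      using no by simp
    then show ?thesis
      using sum_chi_subspace[OF W, of "\<lambda>u. f u + B a u"] by (auto simp: add add_right add_ac)
  qed
  then have "0 = (\<Sum>a\<in>UNIV. \<Sum>u\<in>W. chi (f u + B a u))"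
    by simp
  also have "\<dots> = (\<Sum>u\<in>W. chi (f u) * (\<Sum>a\<in>UNIV. chi (B a u)))"
    by (subst sum.swap) (simp add: sum_distrib_left chi_add)
  also have "\<dots> = (\<Sum>u\<in>W. if u = 0 then int CARD(bit^'m) else 0)"
    by (rule sum.cong) (auto simp: sum_chi_form perp_UNIV \<open>f 0 = 0\<close>)
  also have "\<dots> = int CARD(bit^'m)"
    using \<open>0 \<in> W\<close> by simp
  finally show False by simp
qed

section \<open>Transitivity on totally isotropic subspaces\<close>

lemma id_in_Sp: "id \<in> Sp B"
  by (simp add: Sp_def vec.linear_id)

lemma comp_in_Sp: "g \<in> Sp B \<Longrightarrow> h \<in> Sp B \<Longrightarrow> h \<circ> g \<in> Sp B"
  by (auto simp: Sp_def intro: bij_comp Vector_Spaces.linear_compose)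

text \<open>Homogeneity comes for free from additivity, the only scalars being 0 and 1.\<close>

lemma linear_bitI:
  assumes "\<And>x y. g (x + y) = g x + g y"
  shows "Vector_Spaces.linear (*s) (*s) (g :: bit^'m \<Rightarrow> bit^'m)"
proof (rule Vector_Spaces.linear.intro)
  have "g 0 = 0" using assms[of 0 0] by simp
  then have "g (c *s x) = c *s g x" for c x
    by (cases c) auto
  then show "module_hom (*s) (*s) g"
    by unfold_locales (use assms in auto)
qed unfold_locales

text \<open>The symplectic transvection along \<open>w\<close>: it fixes every vector orthogonal to
  \<open>w\<close> and is an involution in characteristic 2.\<close>

definition transvection :: "bit^'m \<Rightarrow> bit^'m \<Rightarrow> bit^'m" where
  "transvection w x = x + B x w *s w"

lemma transvection_in_Sp: "transvection w \<in> Sp B"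
proof -
  have B: "B (c *s x) y = c * B x y" "B x (c *s y) = c * B x y" for c x y
    by (cases c; simp)+
  have "transvection w (transvection w x) = x" for x
    by (cases "B x w") (simp_all add: transvection_def add_left add.assoc)
  then have "bij (transvection w)"
    by (rule involuntory_imp_bij)
  moreover have "B (transvection w x) (transvection w y) = B x y" for x y
    by (cases "B x w"; cases "B y w") (simp_all add: transvection_def add_left add_right B sym[of w])
  moreover have "Vector_Spaces.linear (*s) (*s) (transvection w)"
    by (rule linear_bitI)
      (simp add: transvection_def add_left vector_sadd_rdistrib algebra_simps)
  ultimately show ?thesis
    by (simp add: Sp_def)
qed

text \<open>One transvection suffices if \<open>B u v = 1\<close>; otherwise two do, through a common
  non-neighbour of \<open>u\<close> and \<open>v\<close> in \<open>perp W\<close>.\<close>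

lemma Sp_move_vector:
  assumes W: "vec.subspace W" and u: "u \<notin> W" "u \<in> perp W" and v: "v \<notin> W" "v \<in> perp W"
  shows "\<exists>h\<in>Sp B. (\<forall>w\<in>W. h w = w) \<and> h u = v"
proof -
  \<comment> \<open>Here \<open>B x (x + y) = 1\<close>, so \<open>x\<close> moves to
    \<open>x + (x + y) = y\<close>; and \<open>x + y\<close> is orthogonal to
    \<open>W\<close>.\<close>
  have step: "transvection (x + y) x = y \<and> (\<forall>w\<in>W. transvection (x + y) w = w)"
    if "B x y = 1" "x \<in> perp W" "y \<in> perp W" for x y
    using that by (auto simp: transvection_def add_right perp_def)
  show ?thesis
  proof (cases "B u v")
    case one
    then show ?thesis
      using step[of u v] u v transvection_in_Sp by blast
  next
    case zero
    have "\<exists>a\<in>perp W. B x a = 1" if "x \<notin> W" for x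
    proof -
      have "x \<notin> perp (perp W)" using that perp_perp[OF W] by simp
      then obtain a where "a \<in> perp W" "B a x \<noteq> 0" by (auto simp: perp_def)
      then show ?thesis by (metis bit_not_zero_iff sym)
    qed
    then obtain a b where ab: "a \<in> perp W" "B u a = 1" "b \<in> perp W" "B v b = 1"
      using u v by meson
    have "\<exists>w\<in>perp W. B u w = 1 \<and> B v w = 1"
    proof (cases "B v a = 1 \<or> B u b = 1")
      case True
      then show ?thesis using ab by blast
    next
      case False
      \<comment> \<open>Now \<open>B v a = 0\<close> and \<open>B u b = 0\<close>, so each of
        \<open>u\<close> and \<open>v\<close> pairs nontrivially with just one summand.\<close>
      then have "B u (a + b) = 1" "B v (a + b) = 1"
        using ab by (simp_all add: add_right)
      then show ?thesis
        using ab subspace_perp[of W] subspace_bit_iff by blast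
    qed
    then obtain w where w: "w \<in> perp W" "B u w = 1" "B w v = 1"
      using sym by metis
    show ?thesis
      using step[of u w] step[of w v] w u v
      by (intro bexI[of _ "transvection (w + v) \<circ> transvection (u + w)"])
        (auto intro: comp_in_Sp transvection_in_Sp)
  qed
qed

lemma Sp_extend:
  assumes "finite S" "vec.independent S" "\<forall>x\<in>S. \<forall>y\<in>S. B x y = 0"
    "inj_on f S" "vec.independent (f ` S)" "\<forall>x\<in>S. \<forall>y\<in>S. B (f x) (f y) = 0"
  shows "\<exists>g\<in>Sp B. \<forall>x\<in>S. g x = f x"
  using assms
proof (induction S rule: finite_induct)
  case empty
  then show ?case using id_in_Sp by auto
next
  case (insert u S)
  have ind: "u \<notin> vec.span S" "vec.independent S"
    using insert.prems(1) insert.hyps by (auto simp: vec.independent_insert)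
  have "f u \<notin> f ` S"
    using insert by auto
  then have ind': "f u \<notin> vec.span (f ` S)" "vec.independent (f ` S)"
    using insert.prems(4) by (auto simp: vec.independent_insert)
  obtain g where g: "g \<in> Sp B" "\<And>x. x \<in> S \<Longrightarrow> g x = f x"
    using insert ind ind' by (auto simp: inj_on_insert)
  have lin: "Vector_Spaces.linear (*s) (*s) g" and inj: "inj g"
    using g by (auto simp: Sp_def bij_def)
  have fS: "f ` S = g ` S"
    using g by auto
  have span_fS: "vec.span (f ` S) = g ` vec.span S"
    using fS vec.linear_span_image[OF lin] by simp
  have perp: "x \<in> perp (vec.span (f ` S))" if "\<And>y. y \<in> S \<Longrightarrow> B (f y) x = 0" for x
  proof -
    have "f ` S \<subseteq> perp {x}"
      using that by (auto simp: perp_def sym[of x])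
    then have "vec.span (f ` S) \<subseteq> perp {x}"
      using subspace_perp by (rule vec.span_minimal)
    then show ?thesis by (auto simp: perp_def sym[of x])
  qed
  have "g u \<notin> vec.span (f ` S)"
    using ind inj by (auto simp: span_fS dest: injD)
  moreover have "g u \<in> perp (vec.span (f ` S))"
  proof (rule perp)
    fix y assume "y \<in> S"
    \<comment> \<open>On \<open>S\<close> the map \<open>f\<close> is the isometry \<open>g\<close>,
      so this value is \<open>B y u\<close>.\<close>
    then show "B (f y) (g u) = 0"
      using g insert.prems(2) by (simp add: Sp_def flip: g(2))
  qed
  moreover have "f u \<in> perp (vec.span (f ` S))"
    using insert.prems by (intro perp) auto
  ultimately obtain h where h: "h \<in> Sp B" "\<And>w. w \<in> vec.span (f ` S) \<Longrightarrow> h w = w" "h (g u) = f u"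
    using Sp_move_vector[OF vec.subspace_span] ind' by blast
  then have "\<forall>x\<in>insert u S. (h \<circ> g) x = f x"
    using g by (auto simp: vec.span_base)
  then show ?case
    using comp_in_Sp[OF g(1) h(1)] by blast
qed

text \<open>Any bijection between bases of the two subspaces meets the hypotheses of
  \<open>Sp_extend\<close>, as the form is zero on both.\<close>

lemma Sp_transitive_totally_isotropic:
  assumes U: "totally_isotropic B U" and U': "totally_isotropic B U'"
    and dim: "vec.dim U = vec.dim U'"
  shows "\<exists>g\<in>Sp B. g ` U = U'"
proof -
  have basis: "\<exists>S. finite S \<and> vec.independent S \<and> vec.span S = W \<and> card S = vec.dim W
      \<and> (\<forall>x\<in>S. \<forall>y\<in>S. B x y = 0)"
    if "totally_isotropic B W" for W
  proof -
    obtain S where S: "S \<subseteq> W" "vec.independent S" "W \<subseteq> vec.span S" "card S = vec.dim W"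
      using vec.basis_exists by blast
    then have "vec.span S = W"
      using that vec.span_minimal by (metis subset_antisym totally_isotropic_def)
    then show ?thesis
      using S that by (intro exI[of _ S]) (auto simp: totally_isotropic_def)
  qed
  obtain S S' where
    S: "finite S" "vec.independent S" "vec.span S = U" "card S = vec.dim U" "\<forall>x\<in>S. \<forall>y\<in>S. B x y = 0" and
    S': "finite S'" "vec.independent S'" "vec.span S' = U'" "card S' = vec.dim U'" "\<forall>x\<in>S'. \<forall>y\<in>S'. B x y = 0"
    using basis[OF U] basis[OF U'] by blast
  then obtain f where f: "bij_betw f S S'"
    using dim by (metis finite_same_card_bij)
  then have "f ` S = S'" "inj_on f S"
    by (auto simp: bij_betw_def)
  then obtain g where g: "g \<in> Sp B" "\<forall>x\<in>S. g x = f x"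
    using Sp_extend[of S f] S S' by auto
  then have "g ` S = S'"
    using \<open>f ` S = S'\<close> by (metis image_cong)
  then have "g ` U = U'"
    using g(1) vec.linear_span_image[of g S] S S' by (simp add: Sp_def)
  then show ?thesis
    using g by blast
qed

section \<open>Gauss sums and types of quadratic forms\<close>

abbreviation quad :: "(bit^'m \<Rightarrow> bit) \<Rightarrow> bool" where
  "quad \<equiv> quadratic_form_polarising_to B"

text \<open>Polarisation at \<open>x = y = 0\<close> gives \<open>\<phi> 0 = 0\<close>, which over
  two scalars already implies the condition on scalar multiples.\<close>

lemma quad_iff: "quad \<phi> \<longleftrightarrow> (\<forall>x y. \<phi> (x + y) = \<phi> x + \<phi> y + B x y)"
proof
  assume q: "quad \<phi>"
  have "\<phi> (x + y) = \<phi> x + \<phi> y + B x y" for x y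
  proof -
    have "\<phi> (x + y) + \<phi> x + \<phi> y = B x y"
      using q by (simp add: quadratic_form_polarising_to_def)
    then show ?thesis
      by (cases "\<phi> x"; cases "\<phi> y"; cases "B x y"; cases "\<phi> (x + y)") simp_all
  qed
  then show "\<forall>x y. \<phi> (x + y) = \<phi> x + \<phi> y + B x y" by blast
next
  assume q: "\<forall>x y. \<phi> (x + y) = \<phi> x + \<phi> y + B x y"
  have "\<phi> 0 = 0"
    using q[rule_format, of 0 0] by simp
  then have "\<phi> (c *s x) = c\<^sup>2 * \<phi> x" for c x
    by (cases c) auto
  moreover have "\<phi> (x + y) + \<phi> x + \<phi> y = B x y" for x y
    unfolding q[rule_format] by (cases "\<phi> x"; cases "\<phi> y"; cases "B x y") simp_all
  ultimately show "quad \<phi>"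
    by (simp add: quadratic_form_polarising_to_def)
qed

lemma quad_add: "quad \<phi> \<Longrightarrow> \<phi> (x + y) = \<phi> x + \<phi> y + B x y"
  by (simp add: quad_iff)

lemma quad_zero: "quad \<phi> \<Longrightarrow> \<phi> 0 = 0"
  using quad_add[of \<phi> 0 0] by simp

definition gauss :: "(bit^'m \<Rightarrow> bit) \<Rightarrow> int" where
  "gauss \<phi> = (\<Sum>x\<in>UNIV. chi (\<phi> x))"

lemma sum_shift: "(\<Sum>x\<in>UNIV. F (x + a)) = (\<Sum>x\<in>UNIV. F x)"
  for F :: "bit^'m \<Rightarrow> int"
  by (rule sum.reindex_bij_witness[of _ "\<lambda>x. x + a" "\<lambda>x. x + a"]) (simp_all add: add.assoc)

text \<open>Replacing \<open>y\<close> by \<open>y + x\<close> cancels \<open>\<phi> x\<close> and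
  leaves \<open>chi (B x y)\<close>, whose sum over \<open>x\<close> vanishes unless
  \<open>y = 0\<close>.\<close>

lemma gauss_square:
  assumes "quad \<phi>"
  shows "(gauss \<phi>)\<^sup>2 = int CARD(bit^'m)"
proof -
  have "(gauss \<phi>)\<^sup>2 = (\<Sum>x\<in>UNIV. \<Sum>y\<in>UNIV. chi (\<phi> x) * chi (\<phi> y))"
    by (simp add: gauss_def power2_eq_square sum_product)
  also have "\<dots> = (\<Sum>x\<in>UNIV. \<Sum>y\<in>UNIV. chi (\<phi> x) * chi (\<phi> (y + x)))"
    by (simp only: sum_shift[of "\<lambda>y. chi (\<phi> _) * chi (\<phi> y)"])
  also have "\<dots> = (\<Sum>x\<in>UNIV. \<Sum>y\<in>UNIV. chi (\<phi> y) * chi (B x y))"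
    by (auto simp: quad_add[OF assms] chi_add chi_def sym intro!: sum.cong)
  also have "\<dots> = (\<Sum>y\<in>UNIV. chi (\<phi> y) * (\<Sum>x\<in>UNIV. chi (B x y)))"
    by (subst sum.swap) (simp add: sum_distrib_left)
  also have "\<dots> = (\<Sum>y\<in>(UNIV :: (bit^'m) set). if y = 0 then int CARD(bit^'m) else 0)"
    by (rule sum.cong) (auto simp: sum_chi_form perp_UNIV quad_zero[OF assms])
  finally show ?thesis
    by simp
qed

text \<open>Translation by a vector \<open>w\<close> of \<open>W\<close> multiplies the sign at
  \<open>x\<close> by \<open>chi (B w x)\<close> alone, since \<open>\<phi> w = 0\<close>; averaging
  over \<open>W\<close> keeps only \<open>perp W\<close>.\<close>

lemma gauss_eq_sum_perp:
  assumes q: "quad \<phi>" and W: "vec.subspace W" "W \<subseteq> Sing \<phi>"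
  shows "gauss \<phi> = (\<Sum>x\<in>perp W. chi (\<phi> x))"
proof -
  have "int (card W) * gauss \<phi> = (\<Sum>w\<in>W. \<Sum>x\<in>UNIV. chi (\<phi> (x + w)))"
    by (simp add: sum_shift[of "\<lambda>x. chi (\<phi> x)"] gauss_def)
  also have "\<dots> = (\<Sum>w\<in>W. \<Sum>x\<in>UNIV. chi (\<phi> x) * chi (B w x))"
    using W by (intro sum.cong) (auto simp: quad_add[OF q] Sing_def chi_add sym subset_iff)
  also have "\<dots> = (\<Sum>x\<in>UNIV. chi (\<phi> x) * (\<Sum>w\<in>W. chi (B w x)))"
    by (subst sum.swap) (simp add: sum_distrib_left)
  also have "\<dots> = (\<Sum>x\<in>UNIV. if x \<in> perp W then int (card W) * chi (\<phi> x) else 0)"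
    by (rule sum.cong) (auto simp: sum_chi_form W)
  also have "\<dots> = int (card W) * (\<Sum>x\<in>perp W. chi (\<phi> x))"
    by (simp add: sum.If_cases sum_distrib_left)
  finally show ?thesis
    using W by (auto simp: subspace_bit_iff)
qed

lemma totally_singular_subset_perp:
  assumes q: "quad \<phi>" and W: "vec.subspace W" "W \<subseteq> Sing \<phi>"
  shows "W \<subseteq> perp W"
proof -
  have "B w x = 0" if "w \<in> W" "x \<in> W" for w x
    using W that quad_add[OF q, of w x] by (auto simp: Sing_def subspace_bit_iff subset_iff)
  then show ?thesis by (auto simp: perp_def)
qed

text \<open>\<open>Max\<close> is meaningful here because the space is finite and the zero subspace
  is totally singular.\<close>

lemma witt_index_attained:
  assumes "quad \<phi>"
  obtains W where "vec.subspace W" "W \<subseteq> Sing \<phi>" "vec.dim W = witt_index \<phi>"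
    "\<And>W'. vec.subspace W' \<Longrightarrow> W' \<subseteq> Sing \<phi> \<Longrightarrow> vec.dim W' \<le> witt_index \<phi>"
proof -
  let ?D = "{vec.dim W | W. vec.subspace W \<and> W \<subseteq> Sing \<phi>}"
  have "?D = vec.dim ` {W. vec.subspace W \<and> W \<subseteq> Sing \<phi>}"
    by auto
  then have fin: "finite ?D"
    by simp
  have "vec.dim {0::bit^'m} \<in> ?D"
    using quad_zero[OF assms] by (auto simp: Sing_def intro!: exI[of _ "{0}"])
  then have "Max ?D \<in> ?D"
    using fin by (intro Max_in) auto
  then obtain W where "vec.subspace W" "W \<subseteq> Sing \<phi>" "vec.dim W = witt_index \<phi>"
    by (auto simp: witt_index_def)
  moreover have "vec.dim W' \<le> witt_index \<phi>" if "vec.subspace W'" "W' \<subseteq> Sing \<phi>" for W'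
    unfolding witt_index_def using that by (intro Max_ge[OF fin]) auto
  ultimately show ?thesis
    using that by simp
qed

text \<open>If \<open>W\<close> is a maximal totally singular subspace then the singular vectors of \<open>perp W\<close> are
  exactly those of \<open>W\<close>, so the Gauss sum is determined by \<open>dim W\<close>.\<close>

lemma gauss_witt_index:
  assumes q: "quad \<phi>" and n: "CARD('m) = 2 * n"
  shows "witt_index \<phi> \<le> n"
    "gauss \<phi> = 2 * 2 ^ witt_index \<phi> - 2 ^ (2 * n - witt_index \<phi>)"
proof -
  obtain W where W: "vec.subspace W" "W \<subseteq> Sing \<phi>" and dim: "vec.dim W = witt_index \<phi>"
    and max: "\<And>W'. vec.subspace W' \<Longrightarrow> W' \<subseteq> Sing \<phi> \<Longrightarrow> vec.dim W' \<le> witt_index \<phi>"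
    using witt_index_attained[OF q] by metis
  define w where "w = witt_index \<phi>"
  have cW: "card W = 2 ^ w"
    using card_subspace[OF W(1)] dim w_def by simp
  have sub: "W \<subseteq> perp W"
    using totally_singular_subset_perp[OF q W] .
  have cV: "2 ^ w * card (perp W) = 2 ^ (2 * n)"
    using card_perp[OF W(1)] by (simp add: cW n)
  have "card (perp W) = 2 ^ vec.dim (perp W)"
    using card_subspace[OF subspace_perp] .
  then have "2 ^ (w + vec.dim (perp W)) = (2::nat) ^ (2 * n)"
    using cV by (simp add: power_add)
  then have wp: "w + vec.dim (perp W) = 2 * n"
    by simp
  then have cP: "card (perp W) = 2 ^ (2 * n - w)"
    using \<open>card (perp W) = 2 ^ vec.dim (perp W)\<close> by (metis add_diff_cancel_left')
  have "vec.dim W \<le> vec.dim (perp W)"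
    using sub by (rule vec.dim_subset)
  then show "witt_index \<phi> \<le> n"
    using wp dim w_def by simp
  \<comment> \<open>Otherwise \<open>x\<close> and \<open>W\<close> would span a larger totally
    singular subspace, against maximality.\<close>
  have sing: "x \<in> W" if "x \<in> perp W" "\<phi> x = 0" for x
  proof (rule ccontr)
    assume x: "x \<notin> W"
    have "\<phi> y = 0" if y: "y \<in> vec.span (insert x W)" for y
    proof -
      obtain c where "y - c *s x \<in> vec.span W"
        using y vec.span_breakdown_eq by blast
      then obtain u where u: "u \<in> W" "y = u + c *s x"
        using W by (metis diff_add_cancel vec.span_eq_iff)
      show ?thesis
        using u W \<open>x \<in> perp W\<close> \<open>\<phi> x = 0\<close>
        by (cases c) (auto simp: quad_add[OF q] Sing_def perp_def)
    qed
    then have "vec.dim (vec.span (insert x W)) \<le> witt_index \<phi>"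
      by (intro max) (auto simp: Sing_def)
    moreover have "vec.dim (insert x W) = vec.dim W + 1"
      using x W by (simp add: vec.dim_insert vec.span_eq_iff[THEN iffD2])
    ultimately show False
      using dim by simp
  qed
  have "gauss \<phi> = (\<Sum>x\<in>perp W. chi (\<phi> x))"
    by (rule gauss_eq_sum_perp[OF q W])
  also have "\<dots> = (\<Sum>x\<in>perp W. (if x \<in> W then 2 else 0) - 1)"
    using sing W by (intro sum.cong) (auto simp: chi_def Sing_def)
  also have "\<dots> = 2 * int (card W) - int (card (perp W))"
    using sub by (simp add: sum_subtractf sum.If_cases Int_absorb1)
  finally show "gauss \<phi> = 2 * 2 ^ witt_index \<phi> - 2 ^ (2 * n - witt_index \<phi>)"
    by (simp add: cW cP w_def)
qed

lemma gauss_cases: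
  assumes "quad \<phi>" "CARD('m) = 2 * n"
  shows "gauss \<phi> = 2 ^ n \<or> gauss \<phi> = - (2 ^ n)"
proof -
  have "(gauss \<phi>)\<^sup>2 = (2 ^ n)\<^sup>2"
    using gauss_square[OF assms(1)] by (simp add: assms(2) power_mult mult.commute[of 2 n])
  then show ?thesis
    by (rule power2_eq_iff[THEN iffD1])
qed

text \<open>Put \<open>j = n - witt_index \<phi>\<close>. Comparing the value
  \<open>2 ^ w * (2 - (2 ^ j)\<^sup>2)\<close> with \<open>2 ^ n\<close> up to sign forces
  \<open>j = 0\<close> with sign plus or \<open>j = 1\<close> with sign minus.\<close>

lemma has_type_iff_gauss:
  assumes q: "quad \<phi>" and n: "CARD('m) = 2 * n" and eps: "\<epsilon> \<in> {1, -1}"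
  shows "has_type \<phi> \<epsilon> \<longleftrightarrow> gauss \<phi> = \<epsilon> * 2 ^ n"
proof -
  define j where "j = n - witt_index \<phi>"
  define w where "w = witt_index \<phi>"
  note g = gauss_witt_index[OF q n]
  have nj: "n = w + j" "2 * n - w = w + 2 * j"
    using g(1) by (auto simp: j_def w_def)
  have gj: "gauss \<phi> = 2 ^ w * (2 - (2 ^ j)\<^sup>2)"
    using g(2) nj by (simp add: w_def[symmetric] power_add right_diff_distrib power_mult
        mult.commute[of 2 j])
  have eq: "gauss \<phi> = e * 2 ^ n \<longleftrightarrow> 2 - (2 ^ j)\<^sup>2 = e * 2 ^ j" for e :: int
    using nj gj by (simp add: power_add)
  have "j = 0 \<or> j = 1"
  proof (rule ccontr)
    \<comment> \<open>For \<open>j \<ge> 2\<close> the square of \<open>2 ^ j\<close> is too large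
      to differ from 2 by only \<open>2 ^ j\<close>.\<close>
    assume "\<not> ?thesis"
    then have "(2::int) ^ 2 \<le> 2 ^ j"
      by (intro power_increasing) auto
    then have "4 \<le> (2::int) ^ j" by simp
    moreover have "2 - (2 ^ j)\<^sup>2 = (2::int) ^ j \<or> 2 - (2 ^ j)\<^sup>2 = - ((2::int) ^ j)"
      using gauss_cases[OF q n] eq[of 1] eq[of "-1"] by simp
    moreover have "4 * 2 ^ j \<le> ((2::int) ^ j)\<^sup>2" 
      using \<open>4 \<le> 2 ^ j\<close> by (simp add: power2_eq_square)
    ultimately show False by linarith
  qed
  moreover have "has_type \<phi> \<epsilon> \<longleftrightarrow> \<epsilon> = 1 \<and> j = 0 \<or> \<epsilon> = -1 \<and> j = 1"
    using g(1) by (auto simp: has_type_def n j_def)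
  ultimately show ?thesis
    using eps by (auto simp: eq)
qed

section \<open>Counting forms that vanish on a subspace\<close>

text \<open>The sum of two forms with the same polarisation is additive, hence of the form
  \<open>B a\<close>.\<close>

lemma quad_translates:
  assumes q: "quad \<phi>"
  shows "{\<psi>. quad \<psi>} = range (\<lambda>a x. \<phi> x + B a x)"
proof (intro equalityI subsetI)
  fix \<psi> assume "\<psi> \<in> {\<psi>. quad \<psi>}"
  then have q': "quad \<psi>" by simp
  have add: "\<phi> (x + y) + \<psi> (x + y) = (\<phi> x + \<psi> x) + (\<phi> y + \<psi> y)" for x y
    unfolding quad_add[OF q] quad_add[OF q']
    by (cases "\<phi> x"; cases "\<phi> y"; cases "\<psi> x"; cases "\<psi> y"; cases "B x y") simp_all
  obtain a where a: "\<And>x. \<phi> x + \<psi> x = B a x"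
    using additive_eq_form[of UNIV "\<lambda>x. \<phi> x + \<psi> x"] add by auto
  have "\<psi> x = \<phi> x + B a x" for x
    unfolding a[symmetric] by (cases "\<phi> x"; cases "\<psi> x") simp_all
  then show "\<psi> \<in> range (\<lambda>a x. \<phi> x + B a x)"
    by auto
next
  fix \<psi> assume "\<psi> \<in> range (\<lambda>a x. \<phi> x + B a x)"
  then obtain a where "\<psi> = (\<lambda>x. \<phi> x + B a x)" by blast
  then show "\<psi> \<in> {\<psi>. quad \<psi>}"
    using q by (simp add: quad_iff add_right add_ac)
qed

lemma inj_translate: "inj (\<lambda>a x. \<phi> x + B a x)"
proof (rule injI)
  fix a b assume "(\<lambda>x. \<phi> x + B a x) = (\<lambda>x. \<phi> x + B b x)"
  then have "B (a + b) x = 0" for x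
    by (simp add: add_left fun_eq_iff)
  then have "a + b = 0"
    by (rule nondegenerate)
  then show "a = b"
    by (metis add.right_neutral vec_bit_add_self_left)
qed

lemma quad_additive_on:
  assumes "quad \<phi>" "totally_isotropic B U" "x \<in> U" "y \<in> U"
  shows "\<phi> (x + y) = \<phi> x + \<phi> y"
  using assms by (simp add: quad_add totally_isotropic_def)

lemma card_perp_dim:
  assumes "vec.subspace W" and n: "CARD('m) = 2 * n"
  shows "card (perp W) = 2 ^ (2 * n - vec.dim W)"
proof -
  have "2 ^ (vec.dim W + vec.dim (perp W)) = (2::nat) ^ (2 * n)"
    using card_perp[OF assms(1)] by (simp add: card_subspace assms subspace_perp power_add)
  then have "vec.dim W + vec.dim (perp W) = 2 * n"
    by simp
  then have "vec.dim (perp W) = 2 * n - vec.dim W"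
    by simp
  then show ?thesis
    by (simp add: card_subspace[OF subspace_perp])
qed

lemma dim_totally_isotropic_le:
  assumes U: "totally_isotropic B U" and n: "CARD('m) = 2 * n"
  shows "vec.dim U \<le> n"
proof -
  have sub: "vec.subspace U" and "U \<subseteq> perp U"
    using U by (auto simp: totally_isotropic_def perp_def)
  then have "card U \<le> card (perp U)"
    by (simp add: card_mono)
  then have "(2::nat) ^ vec.dim U \<le> 2 ^ (2 * n - vec.dim U)"
    by (simp add: card_subspace[OF sub] card_perp_dim[OF sub n])
  then show ?thesis
    by simp
qed

text \<open>The forms vanishing on \<open>U\<close> are a torsor under \<open>perp U\<close>; their number and the sum of
  their Gauss sums together determine how many there are of each type.\<close>

lemma card_forms_vanishing_on:
  assumes n: "CARD('m) = 2 * n" "n \<ge> 1" and eps: "\<epsilon> \<in> {1, -1}"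
    and U: "totally_isotropic B U" and ex: "quad \<phi>0"
  shows "int (card {\<phi> \<in> quad_forms B \<epsilon>. U \<subseteq> Sing \<phi>}) = 2 ^ (n - 1) * (2 ^ (n - vec.dim U) + \<epsilon>)"
proof -
  have sub: "vec.subspace U"
    using U by (simp add: totally_isotropic_def)
  define F where "F = {\<phi>. quad \<phi> \<and> U \<subseteq> Sing \<phi>}"
  \<comment> \<open>As \<open>\<phi>0\<close> is additive on \<open>U\<close>, it agrees there with
    some \<open>B a0\<close>; adding this gives a base form vanishing on \<open>U\<close>.\<close>
  obtain a0 where a0: "\<forall>x\<in>U. \<phi>0 x = B a0 x"
    using additive_eq_form[OF sub, of \<phi>0] quad_additive_on[OF ex U] by blast
  define \<phi> where "\<phi> = (\<lambda>x. \<phi>0 x + B a0 x)"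
  have q: "quad \<phi>"
    using quad_translates[OF ex] by (auto simp: \<phi>_def)
  have vanish: "\<phi> x = 0" if "x \<in> U" for x
    using a0 that by (simp add: \<phi>_def)
  define t where "t = (\<lambda>a x. \<phi> x + B a x)"
  have "{\<psi>. quad \<psi>} = range t"
    using quad_translates[OF q] by (simp add: t_def)
  moreover have "U \<subseteq> Sing (t a) \<longleftrightarrow> a \<in> perp U" for a
    by (auto simp: Sing_def t_def perp_def vanish sym)
  ultimately have F: "F = t ` perp U"
    unfolding F_def by (auto simp: set_eq_iff)
  have inj: "inj_on t (perp U)"
    using inj_translate[of \<phi>] inj_on_subset by (auto simp: t_def)
  have cardF: "card F = 2 ^ (2 * n - vec.dim U)"
    using card_image[OF inj] card_perp_dim[OF sub n(1)] F by simp
  have "(\<Sum>\<psi>\<in>F. gauss \<psi>) = (\<Sum>a\<in>perp U. \<Sum>x\<in>UNIV. chi (\<phi> x) * chi (B a x))"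
    unfolding F sum.reindex[OF inj] by (simp add: o_def gauss_def t_def chi_add)
  \<comment> \<open>The inner sum detects the double perp, which is \<open>U\<close>, and
    \<open>\<phi>\<close> is zero there.\<close>
  also have "\<dots> = (\<Sum>x\<in>UNIV. chi (\<phi> x) * (\<Sum>a\<in>perp U. chi (B a x)))"
    by (subst sum.swap) (simp add: sum_distrib_left)
  also have "\<dots> = (\<Sum>x\<in>UNIV. if x \<in> U then int (card (perp U)) else 0)"
    by (rule sum.cong) (auto simp: sum_chi_form[OF subspace_perp] perp_perp[OF sub] vanish)
  also have "\<dots> = int (card U * card (perp U))"
    by (simp add: sum.If_cases)
  also have "\<dots> = 2 ^ (2 * n)"
    unfolding card_perp[OF sub] by (simp add: n(1))
  finally have sumF: "(\<Sum>\<psi>\<in>F. gauss \<psi>) = 2 ^ (2 * n)" .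
  define N where "N e = {\<phi> \<in> quad_forms B e. U \<subseteq> Sing \<phi>}" for e
  have N: "N e = {\<psi> \<in> F. gauss \<psi> = e * 2 ^ n}" if "e \<in> {1, -1}" for e
    using has_type_iff_gauss[OF _ n(1) that] by (auto simp: N_def F_def quad_forms_def)
  have FN: "F = N 1 \<union> N (-1)"
    using gauss_cases[OF _ n(1)] by (auto simp: N) (auto simp: F_def)
  have disj: "N 1 \<inter> N (-1) = {}"
    by (auto simp: N)
  have "int (card F) = int (card (N 1)) + int (card (N (-1)))"
    using card_Un_disjoint[OF _ _ disj] FN by simp
  then have count: "int (card (N 1)) + int (card (N (-1))) = 2 ^ (2 * n - vec.dim U)"
    by (simp add: cardF)
  have "(\<Sum>\<psi>\<in>F. gauss \<psi>) = (\<Sum>\<psi>\<in>N 1. gauss \<psi>) + (\<Sum>\<psi>\<in>N (-1). gauss \<psi>)"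
    unfolding FN by (rule sum.union_disjoint) (use disj in auto)
  also have "\<dots> = (int (card (N 1)) - int (card (N (-1)))) * 2 ^ n"
    by (simp add: N left_diff_distrib)
  finally have "(int (card (N 1)) - int (card (N (-1)))) * 2 ^ n = 2 ^ n * 2 ^ n"
    using sumF by (simp add: mult_2 power_add)
  then have diff: "int (card (N 1)) - int (card (N (-1))) = 2 ^ n"
    by simp
  \<comment> \<open>The sum and the difference of the two counts are known;
    \<open>\<epsilon>\<close> selects which one is solved for.\<close>
  have "2 * int (card (N \<epsilon>)) = 2 ^ (2 * n - vec.dim U) + \<epsilon> * 2 ^ n"
    using count diff eps by auto
  also have "2 * n - vec.dim U = n + (n - vec.dim U)"
    using dim_totally_isotropic_le[OF U n(1)] by simp
  also have "(2::int) ^ (n + (n - vec.dim U)) + \<epsilon> * 2 ^ n = 2 ^ n * (2 ^ (n - vec.dim U) + \<epsilon>)"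
    by (simp add: power_add algebra_simps)
  also have "(2::int) ^ n = 2 * 2 ^ (n - 1)"
    using n(2) by (metis One_nat_def Suc_pred less_eq_Suc_le power_Suc)
  finally show ?thesis
    by (simp add: N_def)
qed

section \<open>The sets \<open>Delta_set\<close>\<close>

text \<open>A nonzero additive function has sign sum 0 on \<open>U\<close>, so exactly half of
  \<open>U\<close> is singular.\<close>

lemma dim_Sing_Int:
  assumes q: "quad \<phi>" and U: "totally_isotropic B U" and ns: "\<not> U \<subseteq> Sing \<phi>"
  shows "Suc (vec.dim (Sing \<phi> \<inter> U)) = vec.dim U"
proof -
  let ?H = "Sing \<phi> \<inter> U"
  have sub: "vec.subspace U"
    using U by (simp add: totally_isotropic_def)
  have subH: "vec.subspace ?H"
    using sub quad_additive_on[OF q U] quad_zero[OF q] by (auto simp: subspace_bit_iff Sing_def)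
  have "0 = (\<Sum>x\<in>U. chi (\<phi> x))"
    using sum_chi_subspace[OF sub quad_additive_on[OF q U]] ns by (auto simp: Sing_def)
  also have "\<dots> = (\<Sum>x\<in>U. (if \<phi> x = 0 then 2 else 0) - 1)"
    by (intro sum.cong) (auto simp: chi_def)
  also have "\<dots> = 2 * int (card ?H) - int (card U)"
    by (simp add: sum_subtractf sum.If_cases Sing_def Int_commute)
  finally have "int (card U) = int (2 * card ?H)"
    by simp
  then have "(2::nat) ^ vec.dim U = 2 ^ Suc (vec.dim ?H)"
    by (simp only: of_nat_eq_iff card_subspace[OF sub] card_subspace[OF subH] power_Suc)
  then show ?thesis
    by (simp only: power_inject_exp one_less_numeral_iff semiring_norm)
qed

lemma Delta_set_0:
  assumes "totally_isotropic B U"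
  shows "Delta_set B (vec.dim U) \<epsilon> 0 U = {\<phi> \<in> quad_forms B \<epsilon>. U \<subseteq> Sing \<phi>}"
proof -
  have "vec.dim (Sing \<phi> \<inter> U) = vec.dim U \<longleftrightarrow> U \<subseteq> Sing \<phi>" if "quad \<phi>" for \<phi>
    using dim_Sing_Int[OF that assms] by (cases "U \<subseteq> Sing \<phi>") (auto simp: Int_absorb1)
  then show ?thesis
    by (auto simp: Delta_set_def quad_forms_def)
qed

text \<open>The bound \<open>vec.dim U \<ge> 1\<close> keeps the truncated difference
  \<open>vec.dim U - 1\<close> distinct from \<open>vec.dim U\<close>.\<close>

lemma Delta_set_1:
  assumes "totally_isotropic B U" "vec.dim U \<ge> 1"
  shows "Delta_set B (vec.dim U) \<epsilon> 1 U = {\<phi> \<in> quad_forms B \<epsilon>. \<not> U \<subseteq> Sing \<phi>}"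
proof -
  have "vec.dim (Sing \<phi> \<inter> U) = vec.dim U - 1 \<longleftrightarrow> \<not> U \<subseteq> Sing \<phi>" if "quad \<phi>" for \<phi>
    using dim_Sing_Int[OF that assms(1)] assms(2) by (cases "U \<subseteq> Sing \<phi>") (auto simp: Int_absorb1)
  then show ?thesis
    by (auto simp: Delta_set_def quad_forms_def)
qed

text \<open>The second set is the complement of the first, and the number of all forms of type
  \<open>\<epsilon>\<close> is the vanishing count for the zero subspace.\<close>

lemma card_Delta_set:
  assumes n: "CARD('m) = 2 * n" "n \<ge> 1" and eps: "\<epsilon> \<in> {1, -1}"
    and U: "totally_isotropic B U" "vec.dim U \<ge> 1" and ne: "quad_forms B \<epsilon> \<noteq> {}"
  shows "int (card (Delta_set B (vec.dim U) \<epsilon> 0 U)) = 2 ^ (n - 1) * (2 ^ (n - vec.dim U) + \<epsilon>)"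
    "int (card (Delta_set B (vec.dim U) \<epsilon> 1 U)) = 2 ^ (2 * n - vec.dim U - 1) * (2 ^ vec.dim U - 1)"
proof -
  obtain \<phi>0 where q: "quad \<phi>0"
    using ne by (auto simp: quad_forms_def)
  show c0: "int (card (Delta_set B (vec.dim U) \<epsilon> 0 U)) = 2 ^ (n - 1) * (2 ^ (n - vec.dim U) + \<epsilon>)"
    using card_forms_vanishing_on[OF n eps U(1) q] by (simp add: Delta_set_0 U)
  have "totally_isotropic B {0}"
    by (simp add: totally_isotropic_def)
  moreover have "{\<phi> \<in> quad_forms B \<epsilon>. {0} \<subseteq> Sing \<phi>} = quad_forms B \<epsilon>"
    using quad_zero by (auto simp: Sing_def quad_forms_def)
  ultimately have c: "int (card (quad_forms B \<epsilon>)) = 2 ^ (n - 1) * (2 ^ n + \<epsilon>)"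
    using card_forms_vanishing_on[OF n eps _ q, of "{0}"] by simp
  have "Delta_set B (vec.dim U) \<epsilon> 1 U = quad_forms B \<epsilon> - Delta_set B (vec.dim U) \<epsilon> 0 U"
    using Delta_set_0[OF U(1), of \<epsilon>] Delta_set_1[OF U, of \<epsilon>] by auto
  moreover have "Delta_set B (vec.dim U) \<epsilon> 0 U \<subseteq> quad_forms B \<epsilon>"
    by (auto simp: Delta_set_def)
  ultimately have "int (card (Delta_set B (vec.dim U) \<epsilon> 1 U))
      = int (card (quad_forms B \<epsilon>)) - int (card (Delta_set B (vec.dim U) \<epsilon> 0 U))"
    by (simp add: card_Diff_subset card_mono of_nat_diff)
  also have "\<dots> = 2 ^ (n - 1) * (2 ^ n - 2 ^ (n - vec.dim U))"
    unfolding c c0 by (simp add: algebra_simps)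
  also have "\<dots> = 2 ^ (2 * n - vec.dim U - 1) * (2 ^ vec.dim U - 1)"
  proof -
    have "vec.dim U \<le> n"
      using dim_totally_isotropic_le[OF U(1) n(1)] .
    then obtain r where r: "n = vec.dim U + r"
      using le_Suc_ex by blast
    then have "2 * n - vec.dim U - 1 = (n - 1) + r"
      using n(2) by simp
    moreover have "(2::int) ^ n = 2 ^ vec.dim U * 2 ^ r"
      using r by (simp add: power_add)
    ultimately show ?thesis
      using r by (simp add: power_add algebra_simps)
  qed
  finally show "int (card (Delta_set B (vec.dim U) \<epsilon> 1 U))
      = 2 ^ (2 * n - vec.dim U - 1) * (2 ^ vec.dim U - 1)" .
qed

text \<open>The excluded pair is where the first count degenerates: \<open>vec.dim U = n\<close> and
  \<open>\<epsilon> = -1\<close> make its last factor \<open>1 - 1\<close>.\<close>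

lemma Delta_set_nonempty:
  assumes n: "CARD('m) = 2 * n" "n \<ge> 1" and eps: "\<epsilon> \<in> {1, -1}"
    and U: "totally_isotropic B U" "vec.dim U \<ge> 1" and ne: "quad_forms B \<epsilon> \<noteq> {}"
    and excl: "(vec.dim U, \<epsilon>) \<noteq> (n, -1)"
  shows "Delta_set B (vec.dim U) \<epsilon> 0 U \<noteq> {}" "Delta_set B (vec.dim U) \<epsilon> 1 U \<noteq> {}"
proof -
  note c = card_Delta_set[OF n eps U ne]
  have "2 ^ (n - vec.dim U) + \<epsilon> > 0"
  proof (cases "\<epsilon> = 1")
    case False
    then have "n - vec.dim U \<noteq> 0" "\<epsilon> = -1"
      using eps excl dim_totally_isotropic_le[OF U(1) n(1)] by auto
    then show ?thesis
      by simp
  qed (simp add: add_pos_pos)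
  then have "int (card (Delta_set B (vec.dim U) \<epsilon> 0 U)) > 0"
    unfolding c by simp
  then show "Delta_set B (vec.dim U) \<epsilon> 0 U \<noteq> {}"
    by auto
  have "(2::int) ^ vec.dim U > 1"
    using U(2) by simp
  then have "int (card (Delta_set B (vec.dim U) \<epsilon> 1 U)) > 0"
    unfolding c by simp
  then show "Delta_set B (vec.dim U) \<epsilon> 1 U \<noteq> {}"
    by auto
qed

text \<open>The action moves the zero set of a form by \<open>g\<close>, which preserves dimensions.
  That it permutes the forms of type \<open>\<epsilon>\<close> is a hypothesis, later supplied by
  strong incidence-transitivity.\<close>

lemma form_act_Delta_set:
  assumes g: "g \<in> Sp B" and bij: "bij_betw (form_act g) (quad_forms B \<epsilon>) (quad_forms B \<epsilon>)"
  shows "form_act g ` Delta_set B d \<epsilon> \<delta> U = Delta_set B d \<epsilon> \<delta> (g ` U)"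
proof -
  have lin: "Vector_Spaces.linear (*s) (*s) g" and b: "bij g"
    using g by (auto simp: Sp_def)
  have dim: "vec.dim (Sing (form_act g \<phi>) \<inter> g ` U) = vec.dim (Sing \<phi> \<inter> U)" for \<phi>
  proof -
    have "Sing (form_act g \<phi>) = g ` Sing \<phi>"
    proof (intro equalityI subsetI)
      fix x assume "x \<in> Sing (form_act g \<phi>)"
      then have "inv g x \<in> Sing \<phi>" "x = g (inv g x)"
        using b by (simp_all add: Sing_def form_act_def bij_is_surj surj_f_inv_f)
      then show "x \<in> g ` Sing \<phi>" by blast
    qed (use b in \<open>auto simp: Sing_def form_act_def bij_is_inj\<close>)
    then have "Sing (form_act g \<phi>) \<inter> g ` U = g ` (Sing \<phi> \<inter> U)"
      using b by (simp add: bij_is_inj image_Int)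
    then show ?thesis
      using vec.dim_image_eq[OF lin] b by (metis bij_is_inj inj_on_subset subset_UNIV)
  qed
  show ?thesis
  proof (intro equalityI subsetI)
    fix \<psi> assume "\<psi> \<in> form_act g ` Delta_set B d \<epsilon> \<delta> U"
    then show "\<psi> \<in> Delta_set B d \<epsilon> \<delta> (g ` U)"
      using bij by (auto simp: Delta_set_def dim bij_betw_def)
  next
    fix \<psi> assume psi: "\<psi> \<in> Delta_set B d \<epsilon> \<delta> (g ` U)"
    then have "\<psi> \<in> form_act g ` quad_forms B \<epsilon>"
      using bij by (simp add: Delta_set_def bij_betw_def)
    then obtain \<phi> where "\<phi> \<in> quad_forms B \<epsilon>" "\<psi> = form_act g \<phi>"
      by blast
    then show "\<psi> \<in> form_act g ` Delta_set B d \<epsilon> \<delta> U"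
      using psi by (auto simp: Delta_set_def dim)
  qed
qed

lemma totally_isotropic_image:
  assumes "g \<in> Sp B" "totally_isotropic B U"
  shows "totally_isotropic B (g ` U)" "vec.dim (g ` U) = vec.dim U"
proof -
  have lin: "Vector_Spaces.linear (*s) (*s) g" and b: "bij g"
    using assms by (auto simp: Sp_def)
  show "totally_isotropic B (g ` U)"
    using assms vec.linear_subspace_image[OF lin] by (auto simp: totally_isotropic_def Sp_def)
  show "vec.dim (g ` U) = vec.dim U"
    using vec.dim_image_eq[OF lin] b by (metis bij_is_inj inj_on_subset subset_UNIV)
qed

text \<open>Both sides are single orbits of \<open>Sp B\<close>, the right one by transitivity on
  totally isotropic subspaces of equal dimension, so one common member makes them equal.\<close>

lemma code_eq_Gamma_code:
  assumes U: "totally_isotropic B U" and D: "Delta_set B (vec.dim U) \<epsilon> \<delta> U \<in> \<Gamma>"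
    and sit: "strongly_incidence_transitive (Sp B) form_act (quad_forms B \<epsilon>) \<Gamma>"
  shows "\<Gamma> = Gamma_code B (vec.dim U) \<epsilon> \<delta>"
proof -
  have closed: "\<forall>g\<in>Sp B. \<forall>D\<in>\<Gamma>. form_act g ` D \<in> \<Gamma>"
    and trans: "\<forall>D\<in>\<Gamma>. \<forall>E\<in>\<Gamma>. \<exists>g\<in>Sp B. form_act g ` D = E"
    using sit by (simp_all add: strongly_incidence_transitive_def)
  have act: "form_act g ` Delta_set B (vec.dim U) \<epsilon> \<delta> U = Delta_set B (vec.dim U) \<epsilon> \<delta> (g ` U)"
    if "g \<in> Sp B" for g
    using sit that by (intro form_act_Delta_set) (auto simp: strongly_incidence_transitive_def)
  show ?thesis
  proof (intro equalityI subsetI)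
    fix E assume "E \<in> \<Gamma>"
    then obtain g where "g \<in> Sp B" "form_act g ` Delta_set B (vec.dim U) \<epsilon> \<delta> U = E"
      using trans D by blast
    then show "E \<in> Gamma_code B (vec.dim U) \<epsilon> \<delta>"
      using act totally_isotropic_image[OF _ U] unfolding Gamma_code_def by blast
  next
    fix E assume "E \<in> Gamma_code B (vec.dim U) \<epsilon> \<delta>"
    then obtain U' where U': "E = Delta_set B (vec.dim U) \<epsilon> \<delta> U'" "totally_isotropic B U'"
      "vec.dim U' = vec.dim U"
      by (auto simp: Gamma_code_def)
    then obtain g where "g \<in> Sp B" "g ` U = U'"
      using Sp_transitive_totally_isotropic[OF U] by metis
    then show "E \<in> \<Gamma>"
      using act U' D closed by metis
  qed
qed

end

section \<open>Identification of the code from the stabiliser of one codeword\<close>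

theorem theorem5p20:
  fixes B :: "bit^'m \<Rightarrow> bit^'m \<Rightarrow> bit"
    and n d k :: nat
    and \<epsilon> :: int
    and \<Gamma> :: "(bit^'m \<Rightarrow> bit) set set"
    and \<Delta> :: "(bit^'m \<Rightarrow> bit) set"
    and U :: "(bit^'m) set"
  assumes "CARD('m) = 2 * n" and "n \<ge> 2"
    and "symplectic_form B"
    and "\<epsilon> \<in> {1, -1}"
    and "2 \<le> k" and "k + 2 \<le> card (quad_forms B \<epsilon>)"
    and "is_code (johnson_graph (quad_forms B \<epsilon>) k) \<Gamma>"
    and "strongly_incidence_transitive (Sp B) form_act (quad_forms B \<epsilon>) \<Gamma>"
    and "\<Delta> \<in> \<Gamma>"
    and "totally_isotropic B U" and "vec.dim U = d"
    and "1 \<le> d" and "(d, \<epsilon>) \<noteq> (n, -1)"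
    and "setwise_stabiliser (Sp B) form_act \<Delta> \<subseteq> setwise_stabiliser (Sp B) (\<lambda>g. g) U"
  shows "\<exists>\<delta>\<in>{0, 1}. \<Gamma> = Gamma_code B d \<epsilon> \<delta> \<and>
           (\<delta> = 0 \<longrightarrow> int k = 2 ^ (n - 1) * (2 ^ (n - d) + \<epsilon>)) \<and>
           (\<delta> = 1 \<longrightarrow> int k = 2 ^ (2 * n - d - 1) * (2 ^ d - 1))"
proof -
  interpret symplectic B
    using assms(3) by unfold_locales
  let ?Q = "quad_forms B \<epsilon>"
  let ?D = "\<lambda>\<delta>. Delta_set B d \<epsilon> \<delta> U"
  note dim = \<open>vec.dim U = d\<close> and U = \<open>totally_isotropic B U\<close>
  note sit = \<open>strongly_incidence_transitive (Sp B) form_act ?Q \<Gamma>\<close>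
  have n: "CARD('m) = 2 * n" "n \<ge> 1" and d1: "vec.dim U \<ge> 1"
    using assms by auto
  have ne: "?Q \<noteq> {}"
    using assms(6) by auto
  have part: "?D 1 = ?Q - ?D 0" "?D 0 \<subseteq> ?Q"
    using Delta_set_0[OF U, of \<epsilon>] Delta_set_1[OF U d1, of \<epsilon>] dim by auto
  have D0: "?D 0 \<noteq> {}" and D1: "?D 1 \<noteq> {}"
    using Delta_set_nonempty[OF n assms(4) U d1 ne] assms(13) dim by auto
  have Delta: "\<Delta> \<subseteq> ?Q" "card \<Delta> = k"
    using assms(7,9) by (auto simp: is_code_def johnson_graph_def johnson_verts_def)
  have "\<Delta> \<noteq> {}" "?Q - \<Delta> \<noteq> {}"
    using Delta assms(5,6) by auto
  \<comment> \<open>These serve as fixed partners: transitivity on pairs gives transitivity on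
    \<open>\<Delta>\<close> with \<open>q\<close> held fixed, and on the complement with
    \<open>p\<close> held fixed.\<close>
  then obtain p q where p: "p \<in> \<Delta>" and q: "q \<in> ?Q - \<Delta>"
    by blast
  \<comment> \<open>Elements stabilising \<open>\<Delta>\<close> also stabilise \<open>U\<close>,
    hence every set defined from \<open>U\<close> equivariantly.\<close>
  have invariant: "form_act g x \<in> ?D 0"
    if "g \<in> setwise_stabiliser (Sp B) form_act \<Delta>" "x \<in> ?D 0" for g x
  proof -
    have g: "g \<in> Sp B" "g ` U = U"
      using that assms(14) by (auto simp: setwise_stabiliser_def)
    then have "form_act g ` ?D 0 = ?D 0"
      using form_act_Delta_set[OF g(1)] sit by (simp add: strongly_incidence_transitive_def)
    then show ?thesis
      using that by blast
  qed
  have trans: "\<exists>g\<in>setwise_stabiliser (Sp B) form_act \<Delta>. form_act g x = x' \<and> form_act g y = y'"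
    if "x \<in> \<Delta>" "x' \<in> \<Delta>" "y \<in> ?Q - \<Delta>" "y' \<in> ?Q - \<Delta>" for x x' y y'
    using sit assms(9) that unfolding strongly_incidence_transitive_def by fastforce
  have in_block: "\<Delta> \<subseteq> ?D 0" if "x \<in> \<Delta>" "x \<in> ?D 0" for x
  proof
    fix x' assume "x' \<in> \<Delta>"
    then show "x' \<in> ?D 0"
      using trans[of x x' q q] invariant that q by metis
  qed
  have out_block: "?Q - \<Delta> \<subseteq> ?D 0" if "y \<in> ?Q - \<Delta>" "y \<in> ?D 0" for y
  proof
    fix y' assume "y' \<in> ?Q - \<Delta>"
    then show "y' \<in> ?D 0"
      using trans[of p p y y'] invariant that p by metis
  qed
  \<comment> \<open>\<open>?D 0\<close> is a union of the two orbits \<open>\<Delta>\<close> and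
    \<open>?Q - \<Delta>\<close>, and it is neither empty nor all of \<open>?Q\<close>.\<close>
  have "\<Delta> = ?D 0 \<or> \<Delta> = ?D 1"
  proof (cases "\<Delta> \<inter> ?D 0 = {}")
    case True
    then have "?Q - \<Delta> \<subseteq> ?D 0"
      using D0 part(2) out_block by fastforce
    then have "\<Delta> = ?Q - ?D 0"
      using True Delta(1) by blast
    then show ?thesis
      using part(1) by simp
  next
    case False
    then have sub: "\<Delta> \<subseteq> ?D 0"
      using in_block by auto
    moreover have "?D 0 \<subseteq> \<Delta>"
    proof
      fix y assume "y \<in> ?D 0"
      show "y \<in> \<Delta>"
      proof (rule ccontr)
        assume "y \<notin> \<Delta>"
        then have "?Q - \<Delta> \<subseteq> ?D 0"
          using out_block[of y] part(2) \<open>y \<in> ?D 0\<close> by auto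
        then have "?Q \<subseteq> ?D 0"
          using sub by auto
        then show False
          using D1 part(1) by auto
      qed
    qed
    ultimately show ?thesis
      by simp
  qed
  then obtain \<delta> :: nat where \<delta>: "\<delta> \<in> {0, 1}" "\<Delta> = ?D \<delta>"
    by blast
  have "\<Gamma> = Gamma_code B d \<epsilon> \<delta>"
    using code_eq_Gamma_code[OF U _ sit, of \<delta>] \<delta> assms(9) dim by simp
  moreover have "int k = int (card (?D \<delta>))"
    using Delta(2) \<delta>(2) by simp
  ultimately show ?thesis
    using card_Delta_set[OF n assms(4) U d1 ne] \<delta>(1) dim by (intro bexI[of _ \<delta>]) auto
qed

end
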